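(* Let $p,q$ be positive integers, let $E \subseteq [p]\times[q]$, and let $M_E \in \mathbb{R}_{\geq 0}^E$ be a partial matrix with nonnegative entries. Then $M_E$ has a nonnegative rank-$1$ completion if and only if it has a rank-$1$ completion. That is, there exists a matrix $M \in \mathbb{R}_{\geq 0}^{p\times q}$ of nonnegative rank $1$ that agrees with $M_E$ on all positions in $E$ if and only if there exists a matrix $M' \in \mathbb{R}^{p \times q}$ (not necessarily with nonnegative entries) of rank $1$ that agrees with $M_E$ on all positions in $E$.
   Context: $[n]=\{1,\dots,n\}$. For $E \subseteq [p]\times[q]$, a partial matrix $M_E=(m_{ij})_{(i,j)\in E} \in \mathbb{R}^E$ specifies the entries in the positions $E$ (the observed entries); the other positions are missing. A completion of $M_E$ is a matrix in $\mathbb{R}^{p\times q}$ that agrees with $M_E$ on $E$. The nonnegative rank of $M\in\mathbb{R}_{\ge 0}^{p\times q}$ is the smallest $r$ such that $M=AB$ with $A\in\mathbb{R}_{\ge 0}^{p\times r}$, $B\in\mathbb{R}_{\ge 0}^{r\times q}$. A rank-$r$ completion is a completion of rank $r$; a nonnegative rank-$r$ completion is a completion with nonnegative entries and nonnegative rank $r$. *)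

theory Defs
  imports "HOL.Real" "Jordan_Normal_Form.DL_Rank"
begin

text \<open>Matrices are those of \<open>Jordan_Normal_Form.Matrix\<close>, whose rows and columns are numbered
  from 0; so the index set [n] is \<open>{..<n}\<close> here.\<close>

abbreviation mat_rank :: "real mat \<Rightarrow> nat" where
  "mat_rank M \<equiv> vec_space.rank (dim_row M) M"

definition nonneg_entries :: "real mat \<Rightarrow> bool" where
  "nonneg_entries M \<longleftrightarrow> (\<forall>i<dim_row M. \<forall>j<dim_col M. 0 \<le> M $$ (i, j))"

text \<open>Meaningful only if \<open>M\<close> has nonnegative entries: otherwise there is no nonnegative
  factorization, and the value of \<open>LEAST\<close> is unspecified.\<close>

definition nonneg_rank :: "real mat \<Rightarrow> nat" where
  "nonneg_rank M = (LEAST r. \<exists>A \<in> carrier_mat (dim_row M) r. \<exists>B \<in> carrier_mat r (dim_col M).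
     nonneg_entries A \<and> nonneg_entries B \<and> M = A * B)"

text \<open>A partial matrix with observed positions \<open>E\<close> is a function \<open>m\<close> on pairs of indices,
  whose values outside \<open>E\<close> are irrelevant.\<close>

definition is_completion ::
  "nat \<Rightarrow> nat \<Rightarrow> (nat \<times> nat) set \<Rightarrow> (nat \<times> nat \<Rightarrow> real) \<Rightarrow> real mat \<Rightarrow> bool" where
  "is_completion p q E m M \<longleftrightarrow> M \<in> carrier_mat p q \<and> (\<forall>e\<in>E. M $$ e = m e)"

definition has_rank_completion ::
  "nat \<Rightarrow> nat \<Rightarrow> nat \<Rightarrow> (nat \<times> nat) set \<Rightarrow> (nat \<times> nat \<Rightarrow> real) \<Rightarrow> bool" where
  "has_rank_completion r p q E m \<longleftrightarrow> (\<exists>M. is_completion p q E m M \<and> mat_rank M = r)"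

definition has_nonneg_rank_completion ::
  "nat \<Rightarrow> nat \<Rightarrow> nat \<Rightarrow> (nat \<times> nat) set \<Rightarrow> (nat \<times> nat \<Rightarrow> real) \<Rightarrow> bool" where
  "has_nonneg_rank_completion r p q E m \<longleftrightarrow>
     (\<exists>M. is_completion p q E m M \<and> nonneg_entries M \<and> nonneg_rank M = r)"

end

theory Submission
  imports Defs
begin

text \<open>A matrix has rank 1, respectively nonnegative rank 1, iff it is nonzero and of the form
  \<open>f i * g j\<close>, respectively of this form with \<open>f, g \<ge> 0\<close>. Given a rank-1 completion with entries
  \<open>f i * g j\<close>, the matrix with entries \<open>\<bar>f i\<bar> * \<bar>g j\<bar>\<close> is again a completion, because the absolute
  value fixes the nonnegative observed entries.\<close>

text \<open>Dependence would put \<open>v\<close> into the span of the empty set, which contains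
  only the zero vector.\<close>

lemma (in vec_space) lin_indpt_singleton:
  assumes "v \<in> carrier_vec n" "v \<noteq> 0\<^sub>v n"
  shows "lin_indpt {v}"
  using assms lindep_span[of "{v}"] span_empty by auto

lemma (in vec_space) in_span_singletonE:
  assumes "u \<in> span {v}" "v \<in> carrier_vec n"
  obtains a where "u = a \<cdot>\<^sub>v v"
proof -
  obtain a where a: "u = lincomb a {v}"
    using assms finite_span[of "{v}"] by auto
  have "lincomb a {v} = a v \<cdot>\<^sub>v v"
  proof (rule eq_vecI)
    show "dim_vec (lincomb a {v}) = dim_vec (a v \<cdot>\<^sub>v v)"
      using assms lincomb_dim[of "{v}" a] by simp
    show "lincomb a {v} $ i = (a v \<cdot>\<^sub>v v) $ i" if "i < dim_vec (a v \<cdot>\<^sub>v v)" for i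
      using that assms lincomb_index[of i "{v}" a] by simp
  qed
  with a that show thesis by blast
qed

text \<open>A maximal independent set of columns has just one element \<open>w\<close>, so every
  column is a multiple of \<open>w\<close>. Then \<open>f\<close> lists the entries of
  \<open>w\<close>, and \<open>g\<close> the factor belonging to each column.\<close>

lemma (in vec_space) rank_eq_1_imp_product_entries:
  assumes A: "A \<in> carrier_mat n nc" and "rank A = 1"
  obtains f g :: "nat \<Rightarrow> 'a" where "\<And>i j. i < n \<Longrightarrow> j < nc \<Longrightarrow> A $$ (i, j) = f i * g j"
proof -
  have cols: "set (cols A) \<subseteq> carrier_vec n"
    using A cols_dim by blast
  obtain S where S: "maximal S (\<lambda>T. T \<subseteq> set (cols A) \<and> lin_indpt T)"
    using maximal_exists_superset[of "set (cols A)" "\<lambda>T. T \<subseteq> set (cols A) \<and> lin_indpt T" "{}"]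
      finite_lin_indpt2 by auto
  then have max: "B = S" if "S \<subseteq> B" "B \<subseteq> set (cols A)" "lin_indpt B" for B
    using that unfolding maximal_def by blast
  have "card S = 1"
    using S rank_card_indpt[OF A] assms(2) by simp
  then obtain w where "S = {w}"
    by (auto simp: card_1_singleton_iff)
  with S have w: "w \<in> set (cols A)" "lin_indpt {w}"
    by (auto simp: maximal_def)
  then have wc: "w \<in> carrier_vec n"
    using cols by blast
  have "c \<in> span {w}" if c: "c \<in> set (cols A)" for c
  proof (cases "c = w")
    case True
    then show ?thesis using span_self wc by simp
  next
    case False
    \<comment> \<open>Otherwise the column \<open>c\<close>, being different from \<open>w\<close>,
      would properly enlarge the maximal set \<open>S\<close>.\<close>
    have "lin_dep ({w} \<union> {c})"
    proof (rule ccontr)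
      assume "\<not> lin_dep ({w} \<union> {c})"
      then have "{w} \<union> {c} = S"
        using max[of "{w} \<union> {c}"] c w(1) by (simp add: \<open>S = {w}\<close>)
      with False show False by (simp add: \<open>S = {w}\<close>)
    qed
    then show ?thesis
      using lin_dep_iff_in_span[of "{w}" c] wc w(2) c cols False by auto
  qed
  then have "\<exists>a. col A j = a \<cdot>\<^sub>v w" if "j < nc" for j
    using that A wc in_span_singletonE
    by (metis carrier_matD(2) cols_length cols_nth nth_mem)
  then obtain g where g: "\<And>j. j < nc \<Longrightarrow> col A j = g j \<cdot>\<^sub>v w"
    by metis
  have "A $$ (i, j) = w $ i * g j" if "i < n" "j < nc" for i j
  proof -
    have "A $$ (i, j) = col A j $ i" using that A by simp
    then show ?thesis using that g wc by simp
  qed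
  then show thesis by (rule that)
qed

text \<open>The product form bounds the rank by 1 from above, and being nonzero excludes rank 0.
  This shape makes the rank directly comparable with the nonnegative rank.\<close>

lemma (in vec_space) rank_eq_1_iff:
  assumes A: "A \<in> carrier_mat n nc"
  shows "rank A = 1 \<longleftrightarrow>
    A \<noteq> 0\<^sub>m n nc \<and> (\<exists>f g :: nat \<Rightarrow> 'a. \<forall>i<n. \<forall>j<nc. A $$ (i, j) = f i * g j)"
    (is "_ \<longleftrightarrow> _ \<and> ?prod")
proof
  assume "rank A = 1"
  moreover from this have ?prod
    by (metis A rank_eq_1_imp_product_entries)
  ultimately show "A \<noteq> 0\<^sub>m n nc \<and> ?prod"
    using rank_0I by auto
next
  assume R: "A \<noteq> 0\<^sub>m n nc \<and> ?prod"
  then have "rank A \<le> 1"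
    using rank_le_1_product_entries[OF A] A by auto
  obtain i j where ij: "i < n" "j < nc" "A $$ (i, j) \<noteq> 0"
  proof (rule ccontr)
    assume "\<not> thesis"
    then have "A = 0\<^sub>m n nc"
      using A that by (intro eq_matI) auto
    with R show False by simp
  qed
  \<comment> \<open>The column through a nonzero entry is nonzero, hence independent on its own;
    this gives the lower bound on the rank.\<close>
  have "col A j $ i \<noteq> 0\<^sub>v n $ i"
    using ij A by simp
  then have "lin_indpt {col A j}"
    using A by (intro lin_indpt_singleton) auto
  moreover have "{col A j} \<subseteq> set (cols A)"
    using ij A by (auto simp: cols_def)
  ultimately have "1 \<le> rank A"
    using rank_ge_card_indpt[OF A, of "{col A j}"] by simp
  with \<open>rank A \<le> 1\<close> show "rank A = 1" by simp
qed

lemma index_mult_mat_inner_dim_1: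
  fixes A B :: "'a :: semiring_0 mat"
  assumes "A \<in> carrier_mat p 1" "B \<in> carrier_mat 1 q" "i < p" "j < q"
  shows "(A * B) $$ (i, j) = A $$ (i, 0) * B $$ (0, j)"
  using assms by (simp add: scalar_prod_def)

lemma mult_mat_inner_dim_0:
  fixes A B :: "'a :: semiring_0 mat"
  assumes "A \<in> carrier_mat p 0" "B \<in> carrier_mat 0 q"
  shows "A * B = 0\<^sub>m p q"
  using assms by (intro eq_matI) (auto simp: scalar_prod_def)

text \<open>Factorizations of inner dimension 0 yield only the zero matrix, and those of inner
  dimension 1 are products of a nonnegative column and a nonnegative row. The least inner dimension
  is 1 iff the second kind exists and the first does not.\<close>

lemma nonneg_rank_eq_1_iff:
  assumes M: "M \<in> carrier_mat p q" and nonneg: "nonneg_entries M"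
  shows "nonneg_rank M = 1 \<longleftrightarrow> M \<noteq> 0\<^sub>m p q \<and>
    (\<exists>f g. (\<forall>i<p. 0 \<le> f i) \<and> (\<forall>j<q. 0 \<le> g j) \<and> (\<forall>i<p. \<forall>j<q. M $$ (i, j) = f i * g j))"
    (is "_ \<longleftrightarrow> _ \<and> ?prod")
proof -
  define P where "P r \<longleftrightarrow> (\<exists>A \<in> carrier_mat p r. \<exists>B \<in> carrier_mat r q.
    nonneg_entries A \<and> nonneg_entries B \<and> M = A * B)" for r
  have rank: "nonneg_rank M = (LEAST r. P r)"
    using M by (simp add: nonneg_rank_def P_def)
  have P0: "P 0 \<longleftrightarrow> M = 0\<^sub>m p q"
  proof
    assume "M = 0\<^sub>m p q"
    then show "P 0"
      unfolding P_def
      by (intro bexI[of _ "0\<^sub>m p 0"] bexI[of _ "0\<^sub>m 0 q"])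
        (auto simp: nonneg_entries_def mult_mat_inner_dim_0)
  next
    assume "P 0"
    then show "M = 0\<^sub>m p q"
      unfolding P_def using mult_mat_inner_dim_0 by blast
  qed
  have P1: "P 1 \<longleftrightarrow> ?prod"
  proof
    assume "P 1"
    then obtain A B where AB: "A \<in> carrier_mat p 1" "B \<in> carrier_mat 1 q"
      "nonneg_entries A" "nonneg_entries B" "M = A * B"
      unfolding P_def by blast
    then show ?prod
      by (intro exI[of _ "\<lambda>i. A $$ (i, 0)"] exI[of _ "\<lambda>j. B $$ (0, j)"])
        (auto simp: nonneg_entries_def index_mult_mat_inner_dim_1 simp del: index_mult_mat)
  next
    assume ?prod
    then obtain f g where fg: "\<forall>i<p. 0 \<le> f i" "\<forall>j<q. 0 \<le> g j"
      "\<forall>i<p. \<forall>j<q. M $$ (i, j) = f i * g j"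
      by blast
    have "M = mat p 1 (\<lambda>(i, _). f i) * mat 1 q (\<lambda>(_, j). g j)"
      using M fg(3) by (intro eq_matI) (auto simp: scalar_prod_def)
    then show "P 1"
      unfolding P_def using fg(1,2)
      by (intro bexI[of _ "mat p 1 (\<lambda>(i, _). f i)"] bexI[of _ "mat 1 q (\<lambda>(_, j). g j)"])
        (auto simp: nonneg_entries_def)
  qed
  \<comment> \<open>The trivial factorization of \<open>M\<close> as \<open>M\<close> times the
    identity shows that some inner dimension is possible, so the minimum is attained. This is where
    nonnegativity of \<open>M\<close> enters.\<close>
  have "P q"
    unfolding P_def using M nonneg
    by (intro bexI[of _ M] bexI[of _ "1\<^sub>m q"]) (auto simp: nonneg_entries_def)
  then have "P (LEAST r. P r)" by (rule LeastI)
  then have "(LEAST r. P r) = 1 \<longleftrightarrow> \<not> P 0 \<and> P 1"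
    by (metis Least_eq_0 Least_le le_0_eq le_Suc_eq One_nat_def zero_neq_one)
  then show ?thesis
    by (simp only: rank P0 P1)
qed

theorem proposition3p1:
  fixes p q :: nat
    and E :: "(nat \<times> nat) set"
    and m :: "nat \<times> nat \<Rightarrow> real"
  assumes "0 < p" and "0 < q"
    and "E \<subseteq> {..<p} \<times> {..<q}"
    and "\<forall>e\<in>E. 0 \<le> m e"
  shows "has_nonneg_rank_completion 1 p q E m \<longleftrightarrow> has_rank_completion 1 p q E m"
proof
  assume "has_nonneg_rank_completion 1 p q E m"
  then obtain M where M: "is_completion p q E m M" "nonneg_entries M" "nonneg_rank M = 1"
    unfolding has_nonneg_rank_completion_def by blast
  then have "M \<in> carrier_mat p q"
    by (simp add: is_completion_def)
  \<comment> \<open>Nonnegative factors are in particular real factors, so the same matrix serves as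
    the rank-1 completion.\<close>
  with M have "mat_rank M = 1"
    using nonneg_rank_eq_1_iff[of M p q] vec_space.rank_eq_1_iff[of M p q] by auto
  with M(1) show "has_rank_completion 1 p q E m"
    unfolding has_rank_completion_def by blast
next
  assume "has_rank_completion 1 p q E m"
  then obtain M where M: "M \<in> carrier_mat p q" "\<forall>e\<in>E. M $$ e = m e" "mat_rank M = 1"
    unfolding has_rank_completion_def is_completion_def by blast
  then obtain f g where "M \<noteq> 0\<^sub>m p q"
    and fg: "\<forall>i<p. \<forall>j<q. M $$ (i, j) = f i * g j"
    using vec_space.rank_eq_1_iff[of M p q] by (metis carrier_matD(1))
  \<comment> \<open>Defining \<open>N\<close> from \<open>M\<close> itself reduces agreement on
    \<open>E\<close> and \<open>N\<close> being nonzero to entrywise facts; \<open>f\<close> and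
    \<open>g\<close> are needed only for the product form of \<open>N\<close>.\<close>
  define N where "N = map_mat abs M"
  have N: "N \<in> carrier_mat p q" and N_nonneg: "nonneg_entries N"
    using M(1) by (auto simp: N_def nonneg_entries_def)
  have "N $$ e = m e" if e: "e \<in> E" for e
  proof -
    obtain i j where "e = (i, j)" "i < p" "j < q"
      using e assms(3) by auto
    then have "N $$ e = \<bar>M $$ e\<bar>"
      using M(1) by (simp add: N_def)
    with e M(2) assms(4) show ?thesis by simp
  qed
  then have "is_completion p q E m N"
    using N by (simp add: is_completion_def)
  moreover have "N \<noteq> 0\<^sub>m p q"
  proof
    assume N0: "N = 0\<^sub>m p q"
    have "\<bar>M $$ (i, j)\<bar> = 0" if "i < p" "j < q" for i j
      using that M(1) arg_cong[OF N0, of "\<lambda>X. X $$ (i, j)"] by (simp add: N_def)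
    then have "M = 0\<^sub>m p q"
      using M(1) by (intro eq_matI) auto
    with \<open>M \<noteq> 0\<^sub>m p q\<close> show False ..
  qed
  moreover have "\<forall>i<p. \<forall>j<q. N $$ (i, j) = \<bar>f i\<bar> * \<bar>g j\<bar>"
    using M(1) fg by (simp add: N_def abs_mult)
  then have "\<exists>f g. (\<forall>i<p. 0 \<le> f i) \<and> (\<forall>j<q. 0 \<le> g j) \<and> (\<forall>i<p. \<forall>j<q. N $$ (i, j) = f i * g j)"
    by (intro exI[of _ "\<lambda>i. \<bar>f i\<bar>"] exI[of _ "\<lambda>j. \<bar>g j\<bar>"]) simp
  ultimately have "is_completion p q E m N \<and> nonneg_entries N \<and> nonneg_rank N = 1"
    using N_nonneg nonneg_rank_eq_1_iff[OF N N_nonneg] by blast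
  then show "has_nonneg_rank_completion 1 p q E m"
    unfolding has_nonneg_rank_completion_def by blast
qed

end
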